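(* Let $1\le p\le\infty$. For any $u,v\in L^p(X)$, $$\Bigl|\,\|u-\mu_p^X(u)\|_{L^p(X)}-\|v-\mu_p^X(v)\|_{L^p(X)}\Bigr|\le\|u-v\|_{L^p(X)}.$$ Moreover, if $u_n\to u$ in $L^p(X)$, where $1\le p\le\infty$ and, in the case $p=1$, $u_n,u\in C(X)$, then $\mu_p^X(u_n)\to\mu_p^X(u)$ as $n\to\infty$. In particular, the same conclusion holds for any $p\in[1,\infty]$ if $\{u_n\}_{n\in\mathbb{N}}\subset C(X)$ converges to $u$ uniformly on $X$ as $n\to\infty$.
   Context: $X$ is a compact topological space which is also a measure space with respect to a positive (nonzero) Radon measure $\nu$ with $\nu(X)<\infty$; $L^p(X)=L^p(X,\nu)$ (real-valued functions). For $1<p\le\infty$ and $u\in L^p(X)$, and for $p=1$ and $u\in C(X)$, $\mu_p^X(u)$ denotes the unique real number such that $\|u-\mu_p^X(u)\|_{L^p(X)}=\min_{\lambda\in\mathbb{R}}\|u-\lambda\|_{L^p(X)}$. For $p=1$, it is part of the setting that $(X,\nu)$ is such that this minimizer is unique for every $u\in C(X)$. If $p=1$ and $u\in L^1(X)\setminus C(X)$, $\mu_1^X(u)$ is allowed to be any minimizer of $\lambda\mapsto\|u-\lambda\|_{L^1(X)}$ on $\mathbb{R}$. *)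

theory Defs
  imports "HOL-Probability.Essential_Supremum"
begin

text \<open>Positive Radon measures on the Borel sets.  Compact sets need not be Borel when the space is
  not Hausdorff, hence the explicit measurability of \<open>K\<close>.\<close>

definition radon_measure :: "'a::topological_space measure \<Rightarrow> bool" where
  "radon_measure M \<longleftrightarrow>
     sets M = sets borel \<and>
     (\<forall>K. compact K \<and> K \<in> sets M \<longrightarrow> emeasure M K < \<infinity>) \<and>
     (\<forall>A\<in>sets M. emeasure M A = (INF U\<in>{U. open U \<and> A \<subseteq> U}. emeasure M U)) \<and>
     (\<forall>U. open U \<longrightarrow>
        emeasure M U = (SUP K\<in>{K. compact K \<and> K \<in> sets M \<and> K \<subseteq> U}. emeasure M K))"

text \<open>Elements of \<open>L\<^sup>p\<close> are represented by functions rather than by classes modulo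
  almost everywhere equality.\<close>

definition Lp_space :: "'a measure \<Rightarrow> ennreal \<Rightarrow> ('a \<Rightarrow> real) set" where
  "Lp_space M p = {u \<in> borel_measurable M.
     if p = \<infinity> then esssup M (\<lambda>x. ennreal \<bar>u x\<bar>) < \<infinity>
     else integrable M (\<lambda>x. \<bar>u x\<bar> powr enn2real p)}"

definition Lp_norm :: "'a measure \<Rightarrow> ennreal \<Rightarrow> ('a \<Rightarrow> real) \<Rightarrow> real" where
  "Lp_norm M p u =
     (if p = \<infinity> then enn2real (esssup M (\<lambda>x. ennreal \<bar>u x\<bar>))
      else (\<integral>x. \<bar>u x\<bar> powr enn2real p \<partial>M) powr (1 / enn2real p))"

definition Lp_minimizer :: "'a measure \<Rightarrow> ennreal \<Rightarrow> ('a \<Rightarrow> real) \<Rightarrow> real \<Rightarrow> bool" where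
  "Lp_minimizer M p u m \<longleftrightarrow> is_arg_min (\<lambda>c. Lp_norm M p (\<lambda>x. u x - c)) (\<lambda>_. True) m"

text \<open>\<open>\<mu>\<close> is an admissible version of \<open>u \<mapsto> \<mu>\<^sub>p(u)\<close>: it is prescribed except for
  discontinuous \<open>u\<close> in \<open>L\<^sup>1\<close>, where any minimizer may be chosen.\<close>

definition Lp_mean :: "'a::topological_space measure \<Rightarrow> ennreal \<Rightarrow> (('a \<Rightarrow> real) \<Rightarrow> real) \<Rightarrow> bool" where
  "Lp_mean M p \<mu> \<longleftrightarrow> (\<forall>u\<in>Lp_space M p.
     if p = 1 \<and> \<not> continuous_on UNIV u then Lp_minimizer M p u (\<mu> u)
     else \<mu> u = (THE m. Lp_minimizer M p u m))"

end

theory Submission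
  imports Defs
begin

text \<open>Minkowski's inequality makes \<open>\<phi>\<^sub>u c = \<parallel>u - c\<parallel>\<close> a convex coercive function of the real number \<open>c\<close>,
  so a minimizer exists; for \<open>p > 1\<close> it is unique because the midpoint of two distinct minimizers
  would be strictly better.  As \<open>\<phi>\<^sub>u c \<le> \<parallel>u - v\<parallel> + \<phi>\<^sub>v c\<close>, the minimal values of \<open>\<phi>\<^sub>u\<close> and
  \<open>\<phi>\<^sub>v\<close> differ by at most \<open>\<parallel>u - v\<parallel>\<close>.  If \<open>u\<^sub>n\<close> converges to \<open>u\<close>, the same inequality shows that
  \<open>\<mu> u\<^sub>n\<close> is a minimizing sequence of \<open>\<phi>\<^sub>u\<close>, and a minimizing sequence of a convex function on
  the line with a unique minimizer converges to it.\<close>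

section \<open>Convexity and strict midpoint convexity of powers of the absolute value\<close>

text \<open>If neither point is zero, the triangle inequality and monotonicity reduce the claim to
  convexity of \<open>powr\<close> on the positive reals. If one of them is zero, it reduces to
  \<open>s powr q \<le> s\<close> for \<open>0 < s < 1\<close>, which is
  \<open>scale\<close>.\<close>

lemma convex_on_abs_powr:
  fixes q :: real
  assumes "1 \<le> q"
  shows "convex_on UNIV (\<lambda>x::real. \<bar>x\<bar> powr q)"
proof (rule convex_onI)
  fix t x y :: real
  assume t: "0 < t" "t < 1"
  have scale: "\<bar>s * z\<bar> powr q \<le> s * \<bar>z\<bar> powr q" if "0 < s" "s < 1" for s z :: real
  proof -
    have "s powr q \<le> s powr 1"
      using that assms by (intro powr_mono') auto
    then show ?thesis
      using that by (auto simp: abs_mult powr_mult intro!: mult_right_mono)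
  qed
  show "\<bar>(1 - t) *\<^sub>R x + t *\<^sub>R y\<bar> powr q \<le> (1 - t) * \<bar>x\<bar> powr q + t * \<bar>y\<bar> powr q"
  proof (cases "x = 0 \<or> y = 0")
    case True
    then show ?thesis
      using scale[of t y] scale[of "1 - t" x] t by auto
  next
    case False
    have "\<bar>(1 - t) *\<^sub>R x + t *\<^sub>R y\<bar> \<le> (1 - t) * \<bar>x\<bar> + t * \<bar>y\<bar>"
      using t abs_triangle_ineq[of "(1 - t) * x" "t * y"] by (simp add: abs_mult)
    then have "\<bar>(1 - t) *\<^sub>R x + t *\<^sub>R y\<bar> powr q \<le> ((1 - t) * \<bar>x\<bar> + t * \<bar>y\<bar>) powr q"
      using assms by (intro powr_mono2) auto
    also have "\<dots> \<le> (1 - t) * \<bar>x\<bar> powr q + t * \<bar>y\<bar> powr q"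
      using convex_onD[OF powr_convex[OF assms], of t "\<bar>x\<bar>" "\<bar>y\<bar>"] False t by simp
    finally show ?thesis .
  qed
qed simp

text \<open>The mean value theorem on each half of the interval compares the two increments, because
  the derivative \<open>q * z powr (q - 1)\<close> is strictly increasing. The endpoint
  \<open>x = 0\<close> is separate, as the derivative is taken at positive points; there the claim
  amounts to \<open>2 < 2 powr q\<close>.\<close>

lemma powr_midpoint_less:
  fixes x y q :: real
  assumes "1 < q" "0 \<le> x" "x < y"
  shows "((x + y) / 2) powr q < (x powr q + y powr q) / 2"
proof (cases "x = 0")
  case True
  have "2 powr 1 < (2::real) powr q"
    using assms by (intro powr_less_mono) auto
  moreover have "0 < y powr q"
    using assms by simp
  ultimately show ?thesis
    using True assms by (simp add: powr_divide field_simps)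
next
  case False
  define s where "s = (x + y) / 2"
  have s: "0 < x" "x < s" "s < y"
    using assms False by (auto simp: s_def)
  have deriv: "((\<lambda>z. z powr q) has_real_derivative q * z powr (q - 1)) (at z)" if "0 < z" for z
    using has_real_derivative_powr[OF that] .
  obtain a where a: "x < a" "a < s" "s powr q - x powr q = (s - x) * (q * a powr (q - 1))"
    using MVT2[OF \<open>x < s\<close>, of "\<lambda>z. z powr q" "\<lambda>z. q * z powr (q - 1)"] deriv s by auto
  obtain b where b: "s < b" "b < y" "y powr q - s powr q = (y - s) * (q * b powr (q - 1))"
    using MVT2[OF \<open>s < y\<close>, of "\<lambda>z. z powr q" "\<lambda>z. q * z powr (q - 1)"] deriv s by auto
  have "a powr (q - 1) < b powr (q - 1)"
    using a b s assms by (intro powr_less_mono2) auto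
  then have "(s - x) * (q * a powr (q - 1)) < (s - x) * (q * b powr (q - 1))"
    using s assms by simp
  also have eq: "s - x = y - s"
    by (simp add: s_def field_simps)
  finally have "s powr q - x powr q < y powr q - s powr q"
    unfolding a(3) b(3) eq .
  then show ?thesis
    unfolding s_def[symmetric] by simp
qed

text \<open>Distinct numbers of equal modulus are opposite and nonzero, so their midpoint is 0 while
  the right-hand side is positive. Otherwise strictness comes from the moduli.\<close>

lemma abs_powr_midpoint_less:
  fixes a b q :: real
  assumes "1 < q" "a \<noteq> b"
  shows "\<bar>(a + b) / 2\<bar> powr q < (\<bar>a\<bar> powr q + \<bar>b\<bar> powr q) / 2"
proof (cases "\<bar>a\<bar> = \<bar>b\<bar>")
  case True
  then have "b = - a" "a \<noteq> 0"
    using assms by auto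
  then show ?thesis
    by simp
next
  case False
  have "\<bar>(a + b) / 2\<bar> powr q \<le> ((\<bar>a\<bar> + \<bar>b\<bar>) / 2) powr q"
    using assms by (intro powr_mono2) auto
  also have "\<dots> < (\<bar>a\<bar> powr q + \<bar>b\<bar> powr q) / 2"
    using powr_midpoint_less[of q "\<bar>a\<bar>" "\<bar>b\<bar>"] powr_midpoint_less[of q "\<bar>b\<bar>" "\<bar>a\<bar>"] assms False
    by (cases "\<bar>a\<bar> < \<bar>b\<bar>") (auto simp: add.commute)
  finally show ?thesis .
qed

section \<open>Minimization of convex functions on the real line\<close>

text \<open>Convexity supplies continuity, hence a minimum over a compact interval around 0. Outside
  this interval the linear lower bound keeps \<open>f\<close> above \<open>f 0\<close>, so the
  minimum is global.\<close>

lemma convex_coercive_attains_inf: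
  fixes f :: "real \<Rightarrow> real"
  assumes "convex_on UNIV f" "0 < K" "\<And>c. K * \<bar>c\<bar> \<le> f c + B"
  obtains m where "\<And>c. f m \<le> f c"
proof -
  \<comment> \<open>Chosen so that \<open>K * R - B\<close> is at least \<open>f 0\<close>.\<close>
  define R where "R = (\<bar>f 0\<bar> + \<bar>B\<bar>) / K"
  have "continuous_on UNIV f"
    using convex_on_continuous[OF open_UNIV assms(1)] .
  then have "continuous_on {-R..R} f"
    by (rule continuous_on_subset) simp
  moreover have "0 \<le> R"
    using assms(2) by (simp add: R_def)
  ultimately obtain m where m: "m \<in> {-R..R}" "\<And>c. c \<in> {-R..R} \<Longrightarrow> f m \<le> f c"
    using continuous_attains_inf[of "{-R..R}" f] by auto
  have "f m \<le> f c" for c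
  proof (cases "c \<in> {-R..R}")
    case False
    then have "R < \<bar>c\<bar>" by auto
    then have "K * R < K * \<bar>c\<bar>"
      using assms(2) by simp
    then have "f 0 < f c"
      using assms(2) assms(3)[of c] by (simp add: R_def)
    with m(2)[of 0] \<open>0 \<le> R\<close> show ?thesis by auto
  qed (rule m(2))
  with that show thesis by blast
qed

text \<open>A convex function does not decrease along a ray leaving its minimum point. Hence at
  distance at least \<open>e\<close> from \<open>m\<close> its values are bounded below by the
  smaller of \<open>f (m + e)\<close> and \<open>f (m - e)\<close>, which exceeds
  \<open>f m\<close>.\<close>

lemma convex_minimizing_sequence:
  fixes f :: "real \<Rightarrow> real"
  assumes "convex_on UNIV f" and min: "\<And>c. c \<noteq> m \<Longrightarrow> f m < f c"
    and lim: "(\<lambda>n. f (c n)) \<longlonglongrightarrow> f m"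
  shows "c \<longlonglongrightarrow> m"
proof (rule LIMSEQ_I)
  \<comment> \<open>The factor \<open>s\<close> is a direction: 1 for the right ray, -1 for the left
    one. The nearer point is a convex combination of \<open>m\<close> and the farther one, with
    weight \<open>e / d\<close> on the latter.\<close>
  have mono: "f (m + s * e) \<le> f (m + s * d)" if "0 < e" "e \<le> d" for s e d :: real
  proof -
    have "f ((1 - e / d) * m + (e / d) * (m + s * d)) \<le> (1 - e / d) * f m + (e / d) * f (m + s * d)"
      using convex_onD[OF assms(1), of "e / d" m "m + s * d"] that by simp
    also have "(1 - e / d) * m + (e / d) * (m + s * d) = m + s * e"
      using that by (simp add: field_simps)
    also have "(1 - e / d) * f m + (e / d) * f (m + s * d)
        \<le> (1 - e / d) * f (m + s * d) + (e / d) * f (m + s * d)"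
      using that min[of "m + s * d"] by (cases "s = 0") (auto intro!: mult_left_mono)
    finally show ?thesis by (simp add: algebra_simps)
  qed
  fix e :: real assume e: "0 < e"
  have "f m < min (f (m + e)) (f (m - e))"
    using e min by auto
  with lim have "\<forall>\<^sub>F n in sequentially. f (c n) < min (f (m + e)) (f (m - e))"
    by (rule order_tendstoD(2))
  moreover have "norm (c n - m) < e" if less: "f (c n) < min (f (m + e)) (f (m - e))" for n
  proof (rule ccontr)
    assume "\<not> norm (c n - m) < e"
    then consider "e \<le> c n - m" | "e \<le> m - c n"
      by (fastforce simp: abs_if split: if_splits)
    then show False
      using less mono[of e "c n - m" 1] mono[of e "m - c n" "-1"] e by cases auto
  qed
  ultimately show "\<exists>no. \<forall>n\<ge>no. norm (c n - m) < e"
    by (auto simp: eventually_sequentially)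
qed

section \<open>The norm properties of \<open>Lp_norm\<close>\<close>

lemma Lp_space_borel_measurable: "u \<in> Lp_space M p \<Longrightarrow> u \<in> borel_measurable M"
  by (simp add: Lp_space_def)

lemma Lp_norm_nonneg: "0 \<le> Lp_norm M p u"
  by (simp add: Lp_norm_def)

lemma enn2real_ge_1:
  assumes "1 \<le> p" "p \<noteq> \<infinity>"
  shows "1 \<le> enn2real p"
proof -
  have "enn2real 1 \<le> enn2real p"
    using assms by (intro enn2real_mono) (auto simp: less_top)
  then show ?thesis by simp
qed

lemma Lp_norm_powr:
  assumes "1 \<le> p" "p \<noteq> \<infinity>"
  shows "Lp_norm M p u powr enn2real p = (\<integral>x. \<bar>u x\<bar> powr enn2real p \<partial>M)"
proof -
  have "0 \<le> (\<integral>x. \<bar>u x\<bar> powr enn2real p \<partial>M)"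
    by (rule Bochner_Integration.integral_nonneg) simp
  then show ?thesis
    using assms enn2real_ge_1[OF assms] by (simp add: Lp_norm_def powr_powr)
qed

lemma Lp_norm_leI:
  assumes "1 \<le> p" "p \<noteq> \<infinity>" "0 \<le> r" "(\<integral>x. \<bar>u x\<bar> powr enn2real p \<partial>M) \<le> r powr enn2real p"
  shows "Lp_norm M p u \<le> r"
proof (rule ccontr)
  assume "\<not> Lp_norm M p u \<le> r"
  then have "r powr enn2real p < Lp_norm M p u powr enn2real p"
    using assms(3) enn2real_ge_1[OF assms(1,2)] by (intro powr_less_mono2) auto
  with assms(4) show False
    by (simp add: Lp_norm_powr[OF assms(1,2)])
qed

lemma AE_le_Lp_norm_infinity:
  assumes "u \<in> Lp_space M \<infinity>"
  shows "AE x in M. \<bar>u x\<bar> \<le> Lp_norm M \<infinity> u"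
  using esssup_AE[of "\<lambda>x. ennreal \<bar>u x\<bar>" M]
proof eventually_elim
  case (elim x)
  \<comment> \<open>\<open>enn2real\<close> sends \<open>\<infinity>\<close> to 0, so its
    monotonicity requires the finite essential supremum that membership in \<open>Lp_space\<close>
    provides.\<close>
  then have "enn2real (ennreal \<bar>u x\<bar>) \<le> enn2real (esssup M (\<lambda>x. ennreal \<bar>u x\<bar>))"
    using assms by (intro enn2real_mono) (auto simp: Lp_space_def)
  then show ?case
    by (simp add: Lp_norm_def)
qed

text \<open>Together with the a.e. bound just proved, this lets monotonicity, scaling and the
  triangle inequality for \<open>p = \<infinity>\<close> be derived from a.e. estimates.\<close>

lemma
  assumes "u \<in> borel_measurable M" "0 \<le> r" "AE x in M. \<bar>u x\<bar> \<le> r"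
  shows Lp_space_infinityI: "u \<in> Lp_space M \<infinity>"
    and Lp_norm_infinity_leI: "Lp_norm M \<infinity> u \<le> r"
proof -
  have le: "esssup M (\<lambda>x. ennreal \<bar>u x\<bar>) \<le> ennreal r"
    using assms by (intro esssup_I) (auto intro: ennreal_leI)
  then show "u \<in> Lp_space M \<infinity>"
    using assms(1) le_less_trans[OF le ennreal_less_top] by (simp add: Lp_space_def)
  show "Lp_norm M \<infinity> u \<le> r"
    using enn2real_mono[OF le] assms(2) by (simp add: Lp_norm_def)
qed

text \<open>Used below with a constant \<open>v\<close>: to place bounded functions in
  \<open>Lp_space\<close> and to estimate the norm of a uniformly small function.\<close>

lemma
  assumes "1 \<le> p" "v \<in> Lp_space M p" and [measurable]: "u \<in> borel_measurable M"
    and le: "AE x in M. \<bar>u x\<bar> \<le> \<bar>v x\<bar>"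
  shows Lp_space_mono: "u \<in> Lp_space M p"
    and Lp_norm_mono: "Lp_norm M p u \<le> Lp_norm M p v"
proof -
  note [measurable] = Lp_space_borel_measurable[OF assms(2)]
  have "u \<in> Lp_space M p \<and> Lp_norm M p u \<le> Lp_norm M p v"
  proof (cases "p = \<infinity>")
    case True
    have "AE x in M. \<bar>u x\<bar> \<le> Lp_norm M \<infinity> v"
      using le AE_le_Lp_norm_infinity[OF assms(2)[unfolded True]] by eventually_elim simp
    from Lp_space_infinityI[OF assms(3) Lp_norm_nonneg this]
      Lp_norm_infinity_leI[OF assms(3) Lp_norm_nonneg this] True
    show ?thesis by simp
  next
    case False
    define q where "q = enn2real p"
    have q: "1 \<le> q"
      using enn2real_ge_1[OF assms(1) False] by (simp add: q_def)
    have intv: "integrable M (\<lambda>x. \<bar>v x\<bar> powr q)"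
      using assms(2) False by (simp add: Lp_space_def q_def)
    have *: "AE x in M. \<bar>u x\<bar> powr q \<le> \<bar>v x\<bar> powr q"
      using le by eventually_elim (use q in \<open>auto intro: powr_mono2\<close>)
    then have intu: "integrable M (\<lambda>x. \<bar>u x\<bar> powr q)"
      by (intro Bochner_Integration.integrable_bound[OF intv]) auto
    then have "(\<integral>x. \<bar>u x\<bar> powr q \<partial>M) \<le> (\<integral>x. \<bar>v x\<bar> powr q \<partial>M)"
      using intv * by (intro integral_mono_AE)
    then have "Lp_norm M p u \<le> Lp_norm M p v"
      using assms(1) False Lp_norm_nonneg[of M p v]
      by (intro Lp_norm_leI) (auto simp: Lp_norm_powr q_def)
    moreover have "u \<in> Lp_space M p"
      using intu False by (simp add: Lp_space_def q_def)
    ultimately show ?thesis by simp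
  qed
  then show "u \<in> Lp_space M p" "Lp_norm M p u \<le> Lp_norm M p v" by auto
qed

lemma
  assumes "1 \<le> p" "u \<in> Lp_space M p"
  shows Lp_space_cmult: "(\<lambda>x. c * u x) \<in> Lp_space M p"
    and Lp_norm_cmult: "Lp_norm M p (\<lambda>x. c * u x) = \<bar>c\<bar> * Lp_norm M p u"
proof -
  note [measurable] = Lp_space_borel_measurable[OF assms(2)]
  \<comment> \<open>The a.e. estimate gives only an upper bound. For \<open>c \<noteq> 0\<close> the
    reverse inequality follows by applying it to \<open>c * u\<close> with the factor
    \<open>1 / c\<close>.\<close>
  have sup: "(\<lambda>x. d * w x) \<in> Lp_space M \<infinity> \<and> Lp_norm M \<infinity> (\<lambda>x. d * w x) \<le> \<bar>d\<bar> * Lp_norm M \<infinity> w"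
    if w: "w \<in> Lp_space M \<infinity>" for w d
  proof -
    note [measurable] = Lp_space_borel_measurable[OF w]
    have le: "AE x in M. \<bar>d * w x\<bar> \<le> \<bar>d\<bar> * Lp_norm M \<infinity> w"
      using AE_le_Lp_norm_infinity[OF w]
      by eventually_elim (simp add: abs_mult mult_left_mono)
    show ?thesis
      using Lp_space_infinityI[OF _ _ le] Lp_norm_infinity_leI[OF _ _ le] by (simp add: Lp_norm_nonneg)
  qed
  have "(\<lambda>x. c * u x) \<in> Lp_space M p \<and> Lp_norm M p (\<lambda>x. c * u x) = \<bar>c\<bar> * Lp_norm M p u"
  proof (cases "p = \<infinity>")
    case True
    with assms(2) have u: "u \<in> Lp_space M \<infinity>" by simp
    have cu: "(\<lambda>x. c * u x) \<in> Lp_space M \<infinity>" "Lp_norm M \<infinity> (\<lambda>x. c * u x) \<le> \<bar>c\<bar> * Lp_norm M \<infinity> u"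
      using sup[OF u] by auto
    moreover have "\<bar>c\<bar> * Lp_norm M \<infinity> u \<le> Lp_norm M \<infinity> (\<lambda>x. c * u x)"
    proof (cases "c = 0")
      case False
      then have "Lp_norm M \<infinity> u \<le> \<bar>1 / c\<bar> * Lp_norm M \<infinity> (\<lambda>x. c * u x)"
        using sup[OF cu(1), of "1 / c"] by simp
      with False show ?thesis
        by (simp add: field_simps)
    qed (simp add: Lp_norm_nonneg)
    ultimately show ?thesis
      using True by simp
  next
    case False
    have "1 \<le> enn2real p"
      by (rule enn2real_ge_1[OF assms(1) False])
    with False assms show ?thesis
      by (auto simp: Lp_space_def Lp_norm_def abs_mult powr_mult powr_powr
            Bochner_Integration.integral_nonneg)
  qed
  then show "(\<lambda>x. c * u x) \<in> Lp_space M p" "Lp_norm M p (\<lambda>x. c * u x) = \<bar>c\<bar> * Lp_norm M p u"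
    by auto
qed

text \<open>For finite \<open>p\<close>, if \<open>A > \<parallel>u\<parallel>\<close> and \<open>B > \<parallel>v\<parallel>\<close>, then \<open>(u + v) / (A + B)\<close> is a convex combination of
  \<open>u / A\<close> and \<open>v / B\<close>, and integrating the convexity inequality for \<open>|x|\<^sup>p\<close> gives \<open>\<parallel>u + v\<parallel> \<le> A + B\<close>.\<close>

lemma
  assumes "1 \<le> p" "u \<in> Lp_space M p" "v \<in> Lp_space M p"
  shows Lp_space_add: "(\<lambda>x. u x + v x) \<in> Lp_space M p"
    and Lp_norm_triangle: "Lp_norm M p (\<lambda>x. u x + v x) \<le> Lp_norm M p u + Lp_norm M p v"
proof -
  note [measurable] = Lp_space_borel_measurable[OF assms(2)] Lp_space_borel_measurable[OF assms(3)]
  have "(\<lambda>x. u x + v x) \<in> Lp_space M p \<and>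
    Lp_norm M p (\<lambda>x. u x + v x) \<le> Lp_norm M p u + Lp_norm M p v"
  proof (cases "p = \<infinity>")
    case True
    have le: "AE x in M. \<bar>u x + v x\<bar> \<le> Lp_norm M p u + Lp_norm M p v"
      using AE_le_Lp_norm_infinity[OF assms(2)[unfolded True]]
        AE_le_Lp_norm_infinity[OF assms(3)[unfolded True]]
      by eventually_elim (simp add: True)
    show ?thesis
      using Lp_space_infinityI[OF _ _ le] Lp_norm_infinity_leI[OF _ _ le] True
      by (simp add: Lp_norm_nonneg)
  next
    case False
    define q where "q = enn2real p"
    have q: "1 \<le> q"
      using enn2real_ge_1[OF assms(1) False] by (simp add: q_def)
    have int[simp]: "integrable M (\<lambda>x. \<bar>u x\<bar> powr q)" "integrable M (\<lambda>x. \<bar>v x\<bar> powr q)"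
      using assms False by (auto simp: Lp_space_def q_def)
    \<comment> \<open>Strict inequalities make \<open>A\<close> and \<open>B\<close> positive even
      if a norm vanishes, so that division by them is safe. The slack is removed at the end by
      letting it tend to 0.\<close>
    have main: "integrable M (\<lambda>x. \<bar>u x + v x\<bar> powr q) \<and> Lp_norm M p (\<lambda>x. u x + v x) \<le> A + B"
      if A: "Lp_norm M p u < A" and B: "Lp_norm M p v < B" for A B
    proof -
      have pos: "0 < A" "0 < B"
        using A B Lp_norm_nonneg[of M p u] Lp_norm_nonneg[of M p v] by auto
      define t where "t = B / (A + B)"
      have t: "0 \<le> t" "t \<le> 1" "1 - t = A / (A + B)"
        using pos by (auto simp: t_def field_simps)
      define g where "g = (\<lambda>x. (A + B) powr q *
        ((1 - t) / A powr q * \<bar>u x\<bar> powr q + t / B powr q * \<bar>v x\<bar> powr q))"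
      have g: "integrable M g"
        unfolding g_def by simp
      have le: "\<bar>u x + v x\<bar> powr q \<le> g x" for x
      proof -
        have "\<bar>(u x + v x) / (A + B)\<bar> powr q = \<bar>(1 - t) * (u x / A) + t * (v x / B)\<bar> powr q"
          using pos unfolding t(3) by (simp add: t_def add_divide_distrib)
        also have "\<dots> \<le> (1 - t) * \<bar>u x / A\<bar> powr q + t * \<bar>v x / B\<bar> powr q"
          using convex_onD[OF convex_on_abs_powr[OF q], of t "u x / A" "v x / B"] t by simp
        finally show ?thesis
          using pos by (simp add: g_def powr_divide field_simps)
      qed
      have intuv: "integrable M (\<lambda>x. \<bar>u x + v x\<bar> powr q)"
        by (intro Bochner_Integration.integrable_bound[OF g]) (auto intro: order_trans[OF le abs_ge_self])
      have "(\<integral>x. \<bar>u x + v x\<bar> powr q \<partial>M) \<le> integral\<^sup>L M g"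
        using intuv g le by (rule integral_mono)
      also have "integral\<^sup>L M g = (A + B) powr q *
          ((1 - t) / A powr q * Lp_norm M p u powr q + t / B powr q * Lp_norm M p v powr q)"
        unfolding g_def by (simp add: Lp_norm_powr[OF assms(1) False, folded q_def])
      \<comment> \<open>Replacing the norms by \<open>A\<close> and \<open>B\<close> cancels the
        denominators and leaves the weights \<open>1 - t\<close> and \<open>t\<close>, whose sum is
        1.\<close>
      also have "\<dots> \<le> (A + B) powr q * ((1 - t) / A powr q * A powr q + t / B powr q * B powr q)"
        using A B Lp_norm_nonneg[of M p u] Lp_norm_nonneg[of M p v] t q pos
        by (intro mult_left_mono add_mono powr_mono2 divide_nonneg_nonneg) auto
      also have "\<dots> = (A + B) powr q"
        using pos by simp
      finally show ?thesis
        using intuv Lp_norm_leI[OF assms(1) False, of "A + B"] pos by (simp add: q_def)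
    qed
    have "Lp_norm M p (\<lambda>x. u x + v x) \<le> Lp_norm M p u + Lp_norm M p v + e" if "0 < e" for e
      using main[of "Lp_norm M p u + e / 2" "Lp_norm M p v + e / 2"] that by simp
    moreover have "(\<lambda>x. u x + v x) \<in> Lp_space M p"
      using main[of "Lp_norm M p u + 1" "Lp_norm M p v + 1"] False by (simp add: Lp_space_def q_def)
    ultimately show ?thesis
      by (blast intro: field_le_epsilon)
  qed
  then show "(\<lambda>x. u x + v x) \<in> Lp_space M p"
    "Lp_norm M p (\<lambda>x. u x + v x) \<le> Lp_norm M p u + Lp_norm M p v" by auto
qed

section \<open>Constants and the distance from \<open>u\<close> to them\<close>

lemma Lp_space_const:
  assumes "finite_measure M"
  shows "(\<lambda>x. c) \<in> Lp_space M p"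
  using Lp_space_infinityI[of "\<lambda>x. c" M "\<bar>c\<bar>"] finite_measure.integrable_const[OF assms]
  by (auto simp: Lp_space_def)

lemma Lp_norm_const:
  assumes "finite_measure M" "1 \<le> p"
  shows "Lp_norm M p (\<lambda>x. c) = \<bar>c\<bar> * Lp_norm M p (\<lambda>x. 1)"
  using Lp_norm_cmult[OF assms(2) Lp_space_const[OF assms(1), of 1], of c] by simp

text \<open>This norm will be the coercivity constant \<open>K\<close> in the existence of a
  minimizer.\<close>

lemma Lp_norm_one_pos:
  assumes "finite_measure M" "emeasure M (space M) \<noteq> 0"
  shows "0 < Lp_norm M p (\<lambda>x. 1)"
proof -
  interpret finite_measure M by fact
  have "0 < measure M (space M)"
    using assms(2) by (simp add: emeasure_eq_measure zero_less_measure_iff)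
  then show ?thesis
    using esssup_const[OF assms(2), of "1::ennreal"] by (simp add: Lp_norm_def)
qed

lemma
  assumes "1 \<le> p" "u \<in> Lp_space M p" "v \<in> Lp_space M p"
  shows Lp_space_diff: "(\<lambda>x. u x - v x) \<in> Lp_space M p"
    and Lp_norm_triangle_diff: "Lp_norm M p u \<le> Lp_norm M p (\<lambda>x. u x - v x) + Lp_norm M p v"
proof -
  show diff: "(\<lambda>x. u x - v x) \<in> Lp_space M p"
    using Lp_space_add[OF assms(1,2) Lp_space_cmult[OF assms(1,3), of "-1"]] by simp
  show "Lp_norm M p u \<le> Lp_norm M p (\<lambda>x. u x - v x) + Lp_norm M p v"
    using Lp_norm_triangle[OF assms(1) diff assms(3)] by simp
qed

lemma Lp_norm_minus_commute:
  assumes "1 \<le> p" "u \<in> Lp_space M p" "v \<in> Lp_space M p"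
  shows "Lp_norm M p (\<lambda>x. u x - v x) = Lp_norm M p (\<lambda>x. v x - u x)"
  using Lp_norm_cmult[OF assms(1) Lp_space_diff[OF assms], of "-1"] by simp

text \<open>Since \<open>u x - c\<close> is affine in \<open>c\<close>, convexity is the triangle
  inequality combined with homogeneity.\<close>

lemma convex_on_Lp_norm_diff_const:
  assumes "finite_measure M" "1 \<le> p" "u \<in> Lp_space M p"
  shows "convex_on UNIV (\<lambda>c. Lp_norm M p (\<lambda>x. u x - c))"
proof (rule convex_onI)
  fix t a b :: real
  assume t: "0 < t" "t < 1"
  have Lp: "(\<lambda>x. u x - c) \<in> Lp_space M p" for c
    by (rule Lp_space_diff[OF assms(2,3) Lp_space_const[OF assms(1)]])
  have "Lp_norm M p (\<lambda>x. u x - ((1 - t) *\<^sub>R a + t *\<^sub>R b))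
      = Lp_norm M p (\<lambda>x. (1 - t) * (u x - a) + t * (u x - b))"
    by (simp add: algebra_simps)
  also have "\<dots> \<le> Lp_norm M p (\<lambda>x. (1 - t) * (u x - a)) + Lp_norm M p (\<lambda>x. t * (u x - b))"
    by (intro Lp_norm_triangle Lp_space_cmult assms Lp)
  also have "\<dots> = (1 - t) * Lp_norm M p (\<lambda>x. u x - a) + t * Lp_norm M p (\<lambda>x. u x - b)"
    using t by (simp add: Lp_norm_cmult[OF assms(2) Lp])
  finally show "Lp_norm M p (\<lambda>x. u x - ((1 - t) *\<^sub>R a + t *\<^sub>R b))
    \<le> (1 - t) * Lp_norm M p (\<lambda>x. u x - a) + t * Lp_norm M p (\<lambda>x. u x - b)" .
qed simp

section \<open>Existence, uniqueness and stability of minimizers\<close>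

lemma Lp_minimizer_iff:
  "Lp_minimizer M p u m \<longleftrightarrow> (\<forall>c. Lp_norm M p (\<lambda>x. u x - m) \<le> Lp_norm M p (\<lambda>x. u x - c))"
  by (simp add: Lp_minimizer_def is_arg_min_linorder)

text \<open>Coercivity is the triangle inequality for the constant \<open>c = (c - u) + u\<close>,
  with the norm of \<open>u\<close> as additive term.\<close>

lemma Lp_minimizer_exists:
  assumes "finite_measure M" "emeasure M (space M) \<noteq> 0" "1 \<le> p" "u \<in> Lp_space M p"
  shows "\<exists>m. Lp_minimizer M p u m"
proof -
  have "Lp_norm M p (\<lambda>x. 1) * \<bar>c\<bar> \<le> Lp_norm M p (\<lambda>x. u x - c) + Lp_norm M p u" for c
    using Lp_norm_triangle_diff[OF assms(3) Lp_space_const[OF assms(1)] assms(4), of c]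
      Lp_norm_minus_commute[OF assms(3) Lp_space_const[OF assms(1)] assms(4), of c]
    by (simp add: Lp_norm_const[OF assms(1,3), of c] mult.commute)
  then obtain m where "\<And>c. Lp_norm M p (\<lambda>x. u x - m) \<le> Lp_norm M p (\<lambda>x. u x - c)"
    by (rule convex_coercive_attains_inf[OF convex_on_Lp_norm_diff_const[OF assms(1,3,4)]
          Lp_norm_one_pos[OF assms(1,2)]]) blast
  then show ?thesis
    unfolding Lp_minimizer_iff by blast
qed

text \<open>For finite \<open>p\<close>, a strict pointwise inequality at every \<open>x\<close>
  integrates to a strict one because the measure is nonzero. For \<open>p = \<infinity>\<close>,
  almost every value of \<open>u\<close> lies in two intervals of radius \<open>D\<close> with
  distinct centres \<open>a\<close> and \<open>b\<close>, and their intersection is a shorter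
  interval about the midpoint.\<close>

lemma Lp_norm_midpoint_less:
  assumes "finite_measure M" "emeasure M (space M) \<noteq> 0" "1 < p" "u \<in> Lp_space M p" "a \<noteq> b"
    and a: "Lp_norm M p (\<lambda>x. u x - a) = D" and b: "Lp_norm M p (\<lambda>x. u x - b) = D"
  shows "Lp_norm M p (\<lambda>x. u x - (a + b) / 2) < D"
proof -
  interpret finite_measure M by fact
  have p: "1 \<le> p"
    using assms(3) by simp
  note [measurable] = Lp_space_borel_measurable[OF assms(4)]
  have Lp: "(\<lambda>x. u x - c) \<in> Lp_space M p" for c
    by (rule Lp_space_diff[OF p assms(4) Lp_space_const[OF assms(1)]])
  show ?thesis
  proof (cases "p = \<infinity>")
    case True
    \<comment> \<open>The radius of the intersection of the intervals of radius \<open>D\<close>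
      about \<open>a\<close> and \<open>b\<close>.\<close>
    let ?r = "D - \<bar>a / 2 - b / 2\<bar>"
    have "AE x in M. \<bar>u x - a\<bar> \<le> D" "AE x in M. \<bar>u x - b\<bar> \<le> D"
      using AE_le_Lp_norm_infinity[OF Lp[of a, unfolded True]]
        AE_le_Lp_norm_infinity[OF Lp[of b, unfolded True]] a b True by simp_all
    then have le: "AE x in M. \<bar>u x - (a + b) / 2\<bar> \<le> ?r"
      unfolding add_divide_distrib by eventually_elim linarith
    \<comment> \<open>A nonzero measure guarantees a point where the a.e. bound holds, and this
      forces the radius to be nonnegative.\<close>
    have "\<exists>x. \<bar>u x - (a + b) / 2\<bar> \<le> ?r"
    proof (rule ccontr)
      assume "\<nexists>x. \<bar>u x - (a + b) / 2\<bar> \<le> ?r"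
      with le have "AE x in M. False" by simp
      then have "ae_filter M = bot"
        by (simp add: trivial_limit_def)
      with assms(2) show False
        by (simp add: ae_filter_eq_bot_iff)
    qed
    then have "0 \<le> ?r"
      by (auto intro: order_trans[OF abs_ge_zero])
    then have "Lp_norm M p (\<lambda>x. u x - (a + b) / 2) \<le> ?r"
      using Lp_norm_infinity_leI[OF _ _ le] True by simp
    also have "?r < D"
      using assms(5) by simp
    finally show ?thesis .
  next
    case False
    define q where "q = enn2real p"
    have "ennreal 1 < ennreal q"
      using assms(3) False by (simp add: q_def less_top)
    then have q: "1 < q"
      by (simp add: ennreal_less_iff)
    have int[simp]: "integrable M (\<lambda>x. \<bar>u x - c\<bar> powr q)" for c
      using Lp[of c] False by (simp add: Lp_space_def q_def)
    have eq: "(\<integral>x. \<bar>u x - c\<bar> powr q \<partial>M) = Lp_norm M p (\<lambda>x. u x - c) powr q" for c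
      by (simp add: Lp_norm_powr[OF p False] q_def)
    have less: "\<bar>u x - (a + b) / 2\<bar> powr q < (\<bar>u x - a\<bar> powr q + \<bar>u x - b\<bar> powr q) / 2" for x
    proof -
      have mid: "u x - (a + b) / 2 = ((u x - a) + (u x - b)) / 2"
        by (simp add: field_simps)
      show ?thesis
        unfolding mid using assms(5) by (intro abs_powr_midpoint_less[OF q]) simp
    qed
    have "(\<integral>x. \<bar>u x - (a + b) / 2\<bar> powr q \<partial>M)
        < (\<integral>x. (\<bar>u x - a\<bar> powr q + \<bar>u x - b\<bar> powr q) / 2 \<partial>M)"
      by (rule integral_less_AE_space[OF _ _ AE_I2[OF less] assms(2)]) simp_all
    then have "Lp_norm M p (\<lambda>x. u x - (a + b) / 2) powr q < D powr q"
      by (simp add: eq a b)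
    moreover have "0 \<le> D"
      using Lp_norm_nonneg[of M p "\<lambda>x. u x - a"] unfolding a .
    ultimately show ?thesis
      using q powr_mono2[of q D "Lp_norm M p (\<lambda>x. u x - (a + b) / 2)"]
      by (intro not_le_imp_less notI) simp
  qed
qed

lemma Lp_minimizer_unique:
  assumes "finite_measure M" "emeasure M (space M) \<noteq> 0" "1 < p" "u \<in> Lp_space M p"
    and a: "Lp_minimizer M p u a" and b: "Lp_minimizer M p u b"
  shows "a = b"
proof (rule ccontr)
  assume "a \<noteq> b"
  have "Lp_norm M p (\<lambda>x. u x - b) = Lp_norm M p (\<lambda>x. u x - a)"
    using a b by (intro antisym) (simp_all add: Lp_minimizer_iff)
  from Lp_norm_midpoint_less[OF assms(1-4) \<open>a \<noteq> b\<close> refl this] show False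
    using a unfolding Lp_minimizer_iff by (blast dest: leD)
qed

text \<open>The number \<open>b\<close> serves as a competitor for \<open>u\<close>. With a
  minimizer of \<open>v\<close> as \<open>b\<close>, this is one half of the Lipschitz estimate;
  exchanging \<open>u\<close> and \<open>v\<close> gives the other.\<close>

lemma Lp_norm_minimizer_le:
  assumes "finite_measure M" "1 \<le> p" "u \<in> Lp_space M p" "v \<in> Lp_space M p"
    and "Lp_minimizer M p u a"
  shows "Lp_norm M p (\<lambda>x. u x - a) \<le> Lp_norm M p (\<lambda>x. u x - v x) + Lp_norm M p (\<lambda>x. v x - b)"
proof -
  have Lp: "(\<lambda>x. w x - b) \<in> Lp_space M p" if "w \<in> Lp_space M p" for w
    using Lp_space_diff[OF assms(2) that Lp_space_const[OF assms(1)]] .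
  have "Lp_norm M p (\<lambda>x. u x - a) \<le> Lp_norm M p (\<lambda>x. u x - b)"
    using assms(5) by (simp add: Lp_minimizer_iff)
  also have "\<dots> \<le> Lp_norm M p (\<lambda>x. u x - v x) + Lp_norm M p (\<lambda>x. v x - b)"
    using Lp_norm_triangle_diff[OF assms(2) Lp[OF assms(3)] Lp[OF assms(4)]] by simp
  finally show ?thesis .
qed

text \<open>Uniqueness at the limit \<open>u\<close> makes \<open>m\<close> a strict minimum, as
  \<open>convex_minimizing_sequence\<close> demands.\<close>

lemma Lp_minimizer_tendsto:
  assumes M: "finite_measure M" and p: "1 \<le> p"
    and un: "\<And>n. un n \<in> Lp_space M p" and u: "u \<in> Lp_space M p"
    and mn: "\<And>n. Lp_minimizer M p (un n) (mn n)"
    and m: "Lp_minimizer M p u m" and unique: "\<And>c. Lp_minimizer M p u c \<Longrightarrow> c = m"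
    and lim: "(\<lambda>n. Lp_norm M p (\<lambda>x. un n x - u x)) \<longlonglongrightarrow> 0"
  shows "mn \<longlonglongrightarrow> m"
proof -
  let ?f = "\<lambda>c. Lp_norm M p (\<lambda>x. u x - c)"
  have Lp: "(\<lambda>x. w x - c) \<in> Lp_space M p" if "w \<in> Lp_space M p" for w c
    using Lp_space_diff[OF p that Lp_space_const[OF M]] .
  have less: "?f m < ?f c" if "c \<noteq> m" for c
  proof (rule ccontr)
    assume "\<not> ?f m < ?f c"
    then have "?f c \<le> ?f m" by simp
    also have "?f m \<le> ?f d" for d
      using m by (simp add: Lp_minimizer_iff)
    finally have "?f c \<le> ?f d" for d .
    then have "Lp_minimizer M p u c"
      unfolding Lp_minimizer_iff by blast
    with unique that show False by blast
  qed
  \<comment> \<open>The distance is paid twice: once to pass from \<open>u\<close> to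
    \<open>un n\<close>, once to compare the minimal value of \<open>un n\<close> with that of
    \<open>u\<close>.\<close>
  have upper: "?f (mn n) \<le> ?f m + 2 * Lp_norm M p (\<lambda>x. un n x - u x)" for n
  proof -
    have "?f (mn n) \<le> Lp_norm M p (\<lambda>x. u x - un n x) + Lp_norm M p (\<lambda>x. un n x - mn n)"
      using Lp_norm_triangle_diff[OF p Lp[OF u, of "mn n"] Lp[OF un, of n "mn n"]] by simp
    also have "Lp_norm M p (\<lambda>x. un n x - mn n) \<le> Lp_norm M p (\<lambda>x. un n x - u x) + ?f m"
      by (rule Lp_norm_minimizer_le[OF M p un u mn])
    finally show ?thesis
      using Lp_norm_minus_commute[OF p un[of n] u] by simp
  qed
  have "(\<lambda>n. ?f m + 2 * Lp_norm M p (\<lambda>x. un n x - u x)) \<longlonglongrightarrow> ?f m + 2 * 0"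
    by (intro tendsto_add tendsto_const tendsto_mult_left lim)
  then have "(\<lambda>n. ?f (mn n)) \<longlonglongrightarrow> ?f m + 2 * 0"
  proof (rule real_tendsto_sandwich[rotated 3])
    show "(\<lambda>n. ?f m) \<longlonglongrightarrow> ?f m + 2 * 0"
      by simp
    show "\<forall>\<^sub>F n in sequentially. ?f m \<le> ?f (mn n)"
      using m by (simp add: Lp_minimizer_iff)
    show "\<forall>\<^sub>F n in sequentially. ?f (mn n) \<le> ?f m + 2 * Lp_norm M p (\<lambda>x. un n x - u x)"
      by (rule always_eventually) (rule allI, rule upper)
  qed
  then have "(\<lambda>n. ?f (mn n)) \<longlonglongrightarrow> ?f m"
    by simp
  with convex_on_Lp_norm_diff_const[OF M p u] less show ?thesis
    by (rule convex_minimizing_sequence)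
qed

section \<open>Uniform convergence and continuous functions\<close>

lemma Lp_norm_uniform_limit:
  assumes M: "finite_measure M" and p: "1 \<le> p"
    and un: "\<And>n. un n \<in> borel_measurable M" and u: "u \<in> borel_measurable M"
    and lim: "uniform_limit UNIV un u sequentially"
  shows "(\<lambda>n. Lp_norm M p (\<lambda>x. un n x - u x)) \<longlonglongrightarrow> 0"
proof (rule LIMSEQ_I)
  fix e :: real assume e: "0 < e"
  define K where "K = Lp_norm M p (\<lambda>x. 1)"
  have K: "0 \<le> K"
    by (simp add: K_def Lp_norm_nonneg)
  \<comment> \<open>Adding 1 keeps the denominator positive when \<open>K = 0\<close> and makes
    \<open>d * K < e\<close> strict.\<close>
  define d where "d = e / (K + 1)"
  have d: "0 < d" "d * K < e"
    using e K by (auto simp: d_def field_simps)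
  have "\<forall>\<^sub>F n in sequentially. \<forall>x\<in>UNIV. dist (un n x) (u x) < d"
    using lim d by (auto simp: uniform_limit_iff)
  moreover have "norm (Lp_norm M p (\<lambda>x. un n x - u x) - 0) < e"
    if "\<forall>x\<in>UNIV. dist (un n x) (u x) < d" for n
  proof -
    have "AE x in M. \<bar>un n x - u x\<bar> \<le> \<bar>d\<bar>"
      using that d by (auto simp: dist_real_def intro: less_imp_le)
    then have "Lp_norm M p (\<lambda>x. un n x - u x) \<le> Lp_norm M p (\<lambda>x. d)"
      using un u by (intro Lp_norm_mono[OF p Lp_space_const[OF M]]) auto
    also have "\<dots> = d * K"
      using Lp_norm_const[OF M p, of d] d by (simp add: K_def)
    finally show ?thesis
      using d Lp_norm_nonneg[of M p] by simp
  qed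
  ultimately show "\<exists>no. \<forall>n\<ge>no. norm (Lp_norm M p (\<lambda>x. un n x - u x) - 0) < e"
    by (auto simp: eventually_sequentially)
qed

text \<open>A continuous function on a compact space is bounded, hence dominated by a constant,
  which lies in \<open>Lp_space\<close> for a finite measure.\<close>

lemma continuous_Lp_space:
  fixes u :: "'a::topological_space \<Rightarrow> real"
  assumes "compact (UNIV :: 'a set)" "finite_measure M" "sets M = sets borel" "1 \<le> p"
    and "continuous_on UNIV u"
  shows "u \<in> Lp_space M p"
proof -
  have u: "u \<in> borel_measurable M"
    using borel_measurable_continuous_onI[OF assms(5)]
    unfolding measurable_cong_sets[OF assms(3) refl] .
  obtain B where "\<forall>y\<in>range u. norm y \<le> B"
    using compact_imp_bounded[OF compact_continuous_image[OF assms(5,1)]]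
    unfolding bounded_iff by blast
  then have "\<bar>u x\<bar> \<le> \<bar>B\<bar>" for x
    using order_trans[OF _ abs_ge_self, of "\<bar>u x\<bar>" B] by simp
  then have "AE x in M. \<bar>u x\<bar> \<le> \<bar>B\<bar>"
    by (rule AE_I2)
  then show ?thesis
    by (rule Lp_space_mono[OF assms(4) Lp_space_const[OF assms(2)] u])
qed

theorem theorem2p4:
  fixes \<nu> :: "'a::topological_space measure"
    and p :: ennreal
    and \<mu> :: "('a \<Rightarrow> real) \<Rightarrow> real"
  assumes "compact (UNIV :: 'a set)"
    and "radon_measure \<nu>"
    and "emeasure \<nu> (space \<nu>) \<noteq> 0"
    and "emeasure \<nu> (space \<nu>) < \<infinity>"
    and "1 \<le> p"
    and "p = 1 \<Longrightarrow> \<forall>u. continuous_on UNIV u \<longrightarrow> (\<exists>\<^sub>\<le>\<^sub>1 m. Lp_minimizer \<nu> 1 u m)"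
    and "Lp_mean \<nu> p \<mu>"
  shows "(\<forall>u\<in>Lp_space \<nu> p. \<forall>v\<in>Lp_space \<nu> p.
            \<bar>Lp_norm \<nu> p (\<lambda>x. u x - \<mu> u) - Lp_norm \<nu> p (\<lambda>x. v x - \<mu> v)\<bar>
              \<le> Lp_norm \<nu> p (\<lambda>x. u x - v x))
       \<and> (\<forall>un u. (\<forall>n::nat. un n \<in> Lp_space \<nu> p) \<and> u \<in> Lp_space \<nu> p
            \<and> (p = 1 \<longrightarrow> (\<forall>n. continuous_on UNIV (un n)) \<and> continuous_on UNIV u)
            \<and> (\<lambda>n. Lp_norm \<nu> p (\<lambda>x. un n x - u x)) \<longlonglongrightarrow> 0
            \<longrightarrow> (\<lambda>n. \<mu> (un n)) \<longlonglongrightarrow> \<mu> u)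
       \<and> (\<forall>un u. (\<forall>n::nat. continuous_on UNIV (un n)) \<and> uniform_limit UNIV un u sequentially
            \<longrightarrow> (\<lambda>n. \<mu> (un n)) \<longlonglongrightarrow> \<mu> u)"
proof -
  have M: "finite_measure \<nu>"
    using assms(4) by (intro finite_measureI) auto
  have sets: "sets \<nu> = sets borel"
    using assms(2) by (simp add: radon_measure_def)
  \<comment> \<open>Both regimes are merged: for \<open>p = 1\<close> uniqueness is part of the
    setting, for \<open>p > 1\<close> it comes from the strict midpoint inequality.\<close>
  have unique: "a = b" if "u \<in> Lp_space \<nu> p" "p = 1 \<longrightarrow> continuous_on UNIV u"
    "Lp_minimizer \<nu> p u a" "Lp_minimizer \<nu> p u b" for u a b
  proof (cases "p = 1")
    case True
    then have "\<exists>\<^sub>\<le>\<^sub>1 m. Lp_minimizer \<nu> p u m"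
      using assms(6) that(2) by simp
    with that(3,4) show ?thesis
      by (simp add: Uniq_def)
  next
    case False
    with assms(5) have "1 < p" by simp
    from Lp_minimizer_unique[OF M assms(3) this] that show ?thesis by blast
  qed
  \<comment> \<open>In the \<open>THE\<close> branch of \<open>Lp_mean\<close>, existence and
    uniqueness are both required before \<open>\<mu> u\<close> is known to be a minimizer.\<close>
  have minimizer: "Lp_minimizer \<nu> p u (\<mu> u)" if u: "u \<in> Lp_space \<nu> p" for u
  proof (cases "p = 1 \<and> \<not> continuous_on UNIV u")
    case True
    with assms(7) u show ?thesis
      by (auto simp: Lp_mean_def)
  next
    case False
    then have "\<exists>!m. Lp_minimizer \<nu> p u m"
      using Lp_minimizer_exists[OF M assms(3,5) u] unique[OF u] by blast
    moreover have "\<mu> u = (THE m. Lp_minimizer \<nu> p u m)"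
      using assms(7) u False unfolding Lp_mean_def by (metis (no_types, lifting))
    ultimately show ?thesis
      using theI' by metis
  qed
  have lipschitz: "\<bar>Lp_norm \<nu> p (\<lambda>x. u x - \<mu> u) - Lp_norm \<nu> p (\<lambda>x. v x - \<mu> v)\<bar>
      \<le> Lp_norm \<nu> p (\<lambda>x. u x - v x)" if u: "u \<in> Lp_space \<nu> p" and v: "v \<in> Lp_space \<nu> p" for u v
    using Lp_norm_minimizer_le[OF M assms(5) u v minimizer[OF u], of "\<mu> v"]
      Lp_norm_minimizer_le[OF M assms(5) v u minimizer[OF v], of "\<mu> u"]
      Lp_norm_minus_commute[OF assms(5) u v] by simp
  have cont: "(\<lambda>n. \<mu> (un n)) \<longlonglongrightarrow> \<mu> u"
    if "\<And>n::nat. un n \<in> Lp_space \<nu> p" "u \<in> Lp_space \<nu> p" "p = 1 \<longrightarrow> continuous_on UNIV u"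
      "(\<lambda>n. Lp_norm \<nu> p (\<lambda>x. un n x - u x)) \<longlonglongrightarrow> 0" for un u
    by (rule Lp_minimizer_tendsto[OF M assms(5) that(1,2) minimizer[OF that(1)] minimizer[OF that(2)]
          unique[OF that(2,3) _ minimizer[OF that(2)]] that(4)])
  have uniform: "(\<lambda>n. \<mu> (un n)) \<longlonglongrightarrow> \<mu> u"
    if un: "\<And>n::nat. continuous_on UNIV (un n)" and lim: "uniform_limit UNIV un u sequentially" for un u
  proof -
    \<comment> \<open>Continuity passes to the uniform limit, so \<open>u\<close> falls under the
      uniqueness case also when \<open>p = 1\<close>.\<close>
    have u: "continuous_on UNIV u"
      using lim un by (intro uniform_limit_theorem[of _ un]) auto
    note Lp = continuous_Lp_space[OF assms(1) M sets assms(5)]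
    show ?thesis
    proof (rule cont)
      show "(\<lambda>n. Lp_norm \<nu> p (\<lambda>x. un n x - u x)) \<longlonglongrightarrow> 0"
        by (intro Lp_norm_uniform_limit[OF M assms(5) _ _ lim] Lp_space_borel_measurable[OF Lp] un u)
    qed (auto intro: Lp un u)
  qed
  show ?thesis
    by (intro conjI ballI allI impI; (elim conjE)?) (auto intro: lipschitz cont uniform)
qed

end
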